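(* Assume that $f$ is Lipschitz differentiable, i.e. $\nabla f$ is Lipschitz continuous with constant $L_f\ge 0$; that the level set $\{x\in\mathbb{R}^n : F(x)\le F(x^0,\epsilon^0)\}$ is bounded; and that for all $k\in\mathbb{N}$ one has $\nabla Q_k(x^k)=\nabla f(x^k)$, $Q_k$ is strongly convex with constant $M>L_f/2$, $M>0$, and $Q_k$ is Lipschitz differentiable (its gradient is Lipschitz continuous) with constant $L>0$. Let $\{(x^k,\epsilon^k)\}$ be a sequence generated by the IRL1 algorithm, and let $C>0$ be a constant such that $\|\nabla Q_k(x^{k+1})\|_\infty\le C$ for all $k\in\mathbb{N}$ (such a constant exists under these assumptions). Then: (i) If $w(x_i^{\tilde k},\epsilon_i^{\tilde k})>C/\lambda$ for some $\tilde k\in\mathbb{N}$, then $x_i^k\equiv 0$ for all $k>\tilde k$. Conversely, if for any $\tilde k\in\mathbb{N}$ there exists $\hat k>\tilde k$ such that $x_i^{\hat k}\ne 0$, then $w(x_i^k,\epsilon_i^k)\le C/\lambda$ for all $k\in\mathbb{N}$. (ii) There exist index sets $\mathcal{I}^*,\mathcal{A}^*$ with $\mathcal{I}^*\cup\mathcal{A}^*=\{1,\dots,n\}$, and $\bar k>0$, such that $\mathcal{I}(x^k)\equiv\mathcal{I}^*$ and $\mathcal{A}(x^k)\equiv\mathcal{A}^*$ for all $k>\bar k$. (iii) For any $i\in\mathcal{I}^*$, it holds that $$|x_i^k|\ >\ \Big(\frac{C}{p\lambda}\Big)^{\frac{1}{p-1}}-\epsilon_i^k\ >\ 0 .$$ Therefore,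 $\{|x_i^k| : i\in\mathcal{I}^*,\ k\in\mathbb{N}\}$ are bounded away from $0$ after some $\hat k\in\mathbb{N}$. (iv) For any cluster point $x^*$ of $\{x^k\}$, it holds that $\mathcal{I}(x^* )=\mathcal{I}^*$, $\mathcal{A}(x^* )=\mathcal{A}^*$, and $$|x_i^*|\ \ge\ \Big(\frac{C}{p\lambda}\Big)^{\frac{1}{p-1}},\qquad i\in\mathcal{I}^*.$$
   Context: Let $p\in(0,1)$, $\lambda>0$, $f:\mathbb{R}^n\to\mathbb{R}$ continuously differentiable, $F(x)=f(x)+\lambda\sum_{i=1}^n|x_i|^p$, and for $\epsilon\in\mathbb{R}^n_{++}$ let $F(x,\epsilon)=f(x)+\lambda\sum_{i=1}^n(|x_i|+\epsilon_i)^p$. For $x\in\mathbb{R}^n$, $\mathcal{I}(x)=\{i: x_i\ne0\}$ and $\mathcal{A}(x)=\{i: x_i=0\}$. IRL1 algorithm (iteratively reweighted $\ell_1$): given $\mu\in(0,1)$, $x^0\in\mathbb{R}^n$, $\epsilon^0\in\mathbb{R}^n_{++}$, for $k=0,1,2,\dots$ set the weights $w_i^k=w(x_i^k,\epsilon_i^k)=p(|x_i^k|+\epsilon_i^k)^{p-1}$, $i=1,\dots,n$; choose a smooth convex local model $Q_k:\mathbb{R}^n\to\mathbb{R}$ of $f$ at $x^k$; set $x^{k+1}=\arg\min_{x\in\mathbb{R}^n}\{Q_k(x)+\lambda\sum_{i=1}^n w_i^k|x_i|\}$; choose $\epsilon^{k+1}\in\mathbb{R}^n_{++}$ with $\epsilon^{k+1}\le\mu\epsilon^k$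 componentwise.
   Formalization: In (iii) the strict first inequality can fail when C is attained; it is proved as ≥ for all k, and as > at each k where the sup-norm of ∇Q_k(x^{k+1}) is less than C. The second inequality (threshold − ε_i^k > 0) is proved for all sufficiently large k. *)

theory Defs
  imports "HOL-Analysis.Analysis"
begin

definition gradient :: "('a::euclidean_space \<Rightarrow> real) \<Rightarrow> 'a \<Rightarrow> 'a" where
  "gradient f x = (THE D. GDERIV f x :> D)"

lemma gradient_eqI:
  assumes "GDERIV f x :> D"
  shows "gradient f x = D"
  unfolding gradient_def
proof (rule the_equality)
  show "GDERIV f x :> D" by (fact assms)
next
  fix D' assume "GDERIV f x :> D'"
  with assms have "(\<lambda>h. h \<bullet> D') = (\<lambda>h. h \<bullet> D)"
    unfolding gderiv_def by (rule has_derivative_unique[rotated])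
  then show "D' = D"
    by (metis euclidean_eqI inner_commute)
qed

lemma gderiv_gradient:
  assumes "f differentiable (at x)"
  shows "GDERIV f x :> gradient f x"
proof -
  obtain f' where f': "(f has_derivative f') (at x)"
    using assms unfolding differentiable_def by blast
  then interpret linear f' by (rule has_derivative_linear)
  have "f' h = h \<bullet> (\<Sum>b\<in>Basis. f' b *\<^sub>R b)" for h
  proof -
    have "f' h = f' (\<Sum>b\<in>Basis. (h \<bullet> b) *\<^sub>R b)" by (simp add: euclidean_representation)
    also have "\<dots> = (\<Sum>b\<in>Basis. (h \<bullet> b) * f' b)" by (simp add: sum scale)
    also have "\<dots> = h \<bullet> (\<Sum>b\<in>Basis. f' b *\<^sub>R b)"
      by (simp add: inner_sum_right mult.commute)
    finally show ?thesis .
  qed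
  then have "f' = (\<lambda>h. h \<bullet> (\<Sum>b\<in>Basis. f' b *\<^sub>R b))" by (rule ext)
  with f' have "GDERIV f x :> (\<Sum>b\<in>Basis. f' b *\<^sub>R b)"
    unfolding gderiv_def by simp
  then show ?thesis using gradient_eqI by metis
qed

definition continuously_differentiable :: "('a::euclidean_space \<Rightarrow> real) \<Rightarrow> bool" where
  "continuously_differentiable f \<longleftrightarrow>
     (\<forall>x. f differentiable (at x)) \<and> continuous_on UNIV (gradient f)"

text \<open>The library's \<open>lipschitz_on\<close> includes the requirement \<open>0 \<le> L\<close>.\<close>
definition lipschitz_differentiable :: "real \<Rightarrow> ('a::euclidean_space \<Rightarrow> real) \<Rightarrow> bool" where
  "lipschitz_differentiable L f \<longleftrightarrow>
     (\<forall>x. f differentiable (at x)) \<and> L-lipschitz_on UNIV (gradient f)"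

definition strongly_convex :: "real \<Rightarrow> ('a::euclidean_space \<Rightarrow> real) \<Rightarrow> bool" where
  "strongly_convex M q \<longleftrightarrow>
     (\<forall>x y. \<forall>t\<in>{0..1}. q ((1 - t) *\<^sub>R x + t *\<^sub>R y)
        \<le> (1 - t) * q x + t * q y - M / 2 * t * (1 - t) * (norm (x - y))\<^sup>2)"

definition objective :: "real \<Rightarrow> real \<Rightarrow> (real^'n \<Rightarrow> real) \<Rightarrow> real^'n \<Rightarrow> real" where
  "objective p lam f x = f x + lam * (\<Sum>i\<in>UNIV. \<bar>x $ i\<bar> powr p)"

definition perturbed_objective ::
    "real \<Rightarrow> real \<Rightarrow> (real^'n \<Rightarrow> real) \<Rightarrow> real^'n \<Rightarrow> real^'n \<Rightarrow> real" where
  "perturbed_objective p lam f x \<epsilon> = f x + lam * (\<Sum>i\<in>UNIV. (\<bar>x $ i\<bar> + \<epsilon> $ i) powr p)"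

definition weight :: "real \<Rightarrow> real \<Rightarrow> real \<Rightarrow> real" where
  "weight p s e = p * (\<bar>s\<bar> + e) powr (p - 1)"

definition nonzero_indices :: "real^'n \<Rightarrow> 'n set" where
  "nonzero_indices x = {i. x $ i \<noteq> 0}"

definition zero_indices :: "real^'n \<Rightarrow> 'n set" where
  "zero_indices x = {i. x $ i = 0}"

text \<open>
  A run of the iteratively reweighted \<open>\<ell>\<^sub>1\<close> algorithm: \<open>Q k\<close> is the model function chosen in
  step \<open>k\<close>. How \<open>Q k\<close> approximates the smooth part of the objective is not prescribed by the
  algorithm itself; conditions linking the two are imposed separately.
\<close>
definition irl1_sequence ::
    "real \<Rightarrow> real \<Rightarrow> real \<Rightarrow> (nat \<Rightarrow> real^'n \<Rightarrow> real) \<Rightarrow>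
     (nat \<Rightarrow> real^'n) \<Rightarrow> (nat \<Rightarrow> real^'n) \<Rightarrow> bool" where
  "irl1_sequence p lam \<mu> Q x \<epsilon> \<longleftrightarrow>
     (\<forall>i. 0 < \<epsilon> 0 $ i) \<and>
     (\<forall>k. continuously_differentiable (Q k) \<and> convex_on UNIV (Q k) \<and>
          is_arg_min
            (\<lambda>z. Q k z + lam * (\<Sum>i\<in>UNIV. weight p (x k $ i) (\<epsilon> k $ i) * \<bar>z $ i\<bar>))
            (\<lambda>z. z \<in> UNIV) (x (Suc k)) \<and>
          (\<forall>i. 0 < \<epsilon> (Suc k) $ i \<and> \<epsilon> (Suc k) $ i \<le> \<mu> * \<epsilon> k $ i))"

end

theory Submission
  imports Defs
begin

text \<open>
  The support of the iterates settles because the weights act as a one-way switch. A coordinate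
  of the minimizer of \<open>Q k z + lam * (\<Sum>i\<in>UNIV. w i * \<bar>z $ i\<bar>)\<close> must vanish if \<open>lam * w i\<close> exceeds
  the absolute value of the corresponding entry of the model gradient (\<open>weighted_l1_minimizer_component_zero\<close>), and \<open>C\<close> bounds all these
  entries. The weight is a strictly decreasing function of \<open>\<bar>x k $ i\<bar> + \<epsilon> k $ i\<close>, so exceeding
  \<open>C / lam\<close> means that this sum lies below \<open>T = (C / (p * lam)) powr (1 / (p - 1))\<close>
  (\<open>weight_threshold\<close>). If that happens once, the coordinate becomes zero, the sum shrinks to
  the next perturbation, and the situation persists (\<open>zero_after_threshold\<close>). Hence every
  coordinate that is nonzero infinitely often keeps its sum at or above \<open>T\<close> at all times; since
  \<open>\<epsilon> k\<close> tends to zero, such a coordinate is eventually bounded away from zero, and so are its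
  limits along subsequences. All other coordinates are eventually zero.

  That a bound \<open>C\<close> exists follows from monotonicity of the perturbed objective. In one step the
  penalty is majorized by its linearization (\<open>powr_le_tangent\<close>), whose slopes are the weights,
  and \<open>f\<close> is compared with the strongly convex model through the common gradient
  (\<open>model_minimization_step_decrease\<close>). The iterates then stay in the bounded level set, where
  the Lipschitz gradients of \<open>f\<close> and of the models are uniformly bounded.
\<close>

section \<open>First-order inequalities\<close>

lemma gderiv_difference_quotient:
  fixes q :: "'a::euclidean_space \<Rightarrow> real"
  assumes "GDERIV q z :> g"
  shows "((\<lambda>t. (q (z + t *\<^sub>R d) - q z) / t) \<longlongrightarrow> d \<bullet> g) (at_right 0)"
proof -
  have "(q has_derivative (\<lambda>h. h \<bullet> g)) (at (z + 0 *\<^sub>R d))"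
    using assms by (simp add: gderiv_def)
  moreover have "((\<lambda>t::real. z + t *\<^sub>R d) has_derivative (\<lambda>t. t *\<^sub>R d)) (at 0)"
    by (auto intro!: derivative_eq_intros)
  ultimately have "((\<lambda>t. q (z + t *\<^sub>R d)) has_derivative (\<lambda>t. (t *\<^sub>R d) \<bullet> g)) (at 0)"
    by (rule has_derivative_compose[rotated])
  then have "((\<lambda>t. q (z + t *\<^sub>R d)) has_real_derivative (d \<bullet> g)) (at 0)"
    by (simp add: has_field_derivative_def mult_commute_abs)
  then have "((\<lambda>t. (q (z + t *\<^sub>R d) - q z) / t) \<longlongrightarrow> d \<bullet> g) (at 0)"
    by (simp add: DERIV_def)
  then show ?thesis
    by (rule tendsto_mono[rotated]) (simp add: at_le)
qed

lemma eventually_at_right_unit: "\<forall>\<^sub>F t::real in at_right 0. 0 < t \<and> t < 1"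
  using eventually_at_right_real[of 0 1] by simp

text \<open>Convexity of \<open>\<phi>\<close> bounds its increase along the segment from \<open>z\<close> to \<open>y\<close> by a linear
  function of the step length, so minimality of \<open>z\<close> turns into a bound on the difference
  quotient of the smooth part.\<close>

lemma composite_minimizer_variational_inequality:
  fixes q \<phi> :: "'a::euclidean_space \<Rightarrow> real"
  assumes q: "GDERIV q z :> g"
    and \<phi>: "convex_on UNIV \<phi>"
    and min: "\<And>y. q z + \<phi> z \<le> q y + \<phi> y"
  shows "\<phi> z - \<phi> y \<le> (y - z) \<bullet> g"
proof (rule tendsto_lowerbound)
  show "((\<lambda>t. (q (z + t *\<^sub>R (y - z)) - q z) / t) \<longlongrightarrow> (y - z) \<bullet> g) (at_right 0)"
    using q by (rule gderiv_difference_quotient)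
  show "\<forall>\<^sub>F t in at_right 0. \<phi> z - \<phi> y \<le> (q (z + t *\<^sub>R (y - z)) - q z) / t"
    using eventually_at_right_unit
  proof eventually_elim
    case (elim t)
    have "z + t *\<^sub>R (y - z) = (1 - t) *\<^sub>R z + t *\<^sub>R y" by (simp add: algebra_simps)
    moreover have "\<phi> ((1 - t) *\<^sub>R z + t *\<^sub>R y) \<le> (1 - t) * \<phi> z + t * \<phi> y"
      using convex_onD[OF \<phi>, of t z y] elim by simp
    ultimately have "t * (\<phi> z - \<phi> y) \<le> q (z + t *\<^sub>R (y - z)) - q z"
      using min[of "z + t *\<^sub>R (y - z)"] by (simp add: algebra_simps)
    then show ?case using elim by (simp add: field_simps)
  qed
qed simp

text \<open>The defining inequality, divided by the step length \<open>t\<close>, bounds the difference quotient at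
  \<open>z\<close>; the factor \<open>1 - t\<close> disappears in the limit.\<close>

lemma strongly_convex_lower_bound:
  fixes q :: "'a::euclidean_space \<Rightarrow> real"
  assumes q: "GDERIV q z :> g" and sc: "strongly_convex M q"
  shows "q z + (y - z) \<bullet> g + M / 2 * (norm (y - z))\<^sup>2 \<le> q y"
proof -
  let ?n = "(norm (y - z))\<^sup>2"
  have "(y - z) \<bullet> g \<le> q y - q z - M / 2 * (1 - 0) * ?n"
  proof (rule tendsto_le)
    show "((\<lambda>t. (q (z + t *\<^sub>R (y - z)) - q z) / t) \<longlongrightarrow> (y - z) \<bullet> g) (at_right 0)"
      using q by (rule gderiv_difference_quotient)
    show "((\<lambda>t. q y - q z - M / 2 * (1 - t) * ?n) \<longlongrightarrow> q y - q z - M / 2 * (1 - 0) * ?n) (at_right 0)"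
      by (intro tendsto_intros)
    show "\<forall>\<^sub>F t in at_right 0.
        (q (z + t *\<^sub>R (y - z)) - q z) / t \<le> q y - q z - M / 2 * (1 - t) * ?n"
      using eventually_at_right_unit
    proof eventually_elim
      case (elim t)
      have "z + t *\<^sub>R (y - z) = (1 - t) *\<^sub>R z + t *\<^sub>R y" by (simp add: algebra_simps)
      moreover have "q ((1 - t) *\<^sub>R z + t *\<^sub>R y)
          \<le> (1 - t) * q z + t * q y - M / 2 * t * (1 - t) * ?n"
        using sc elim unfolding strongly_convex_def by (simp add: norm_minus_commute[of y z])
      ultimately have "q (z + t *\<^sub>R (y - z)) - q z \<le> t * (q y - q z - M / 2 * (1 - t) * ?n)"
        by (simp add: algebra_simps)
      then show ?case using elim by (simp add: pos_divide_le_eq mult.commute)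
    qed
  qed simp
  then show ?thesis by simp
qed

text \<open>Along the segment from \<open>y\<close> to \<open>z\<close>, subtracting the quadratic model from \<open>f\<close> leaves a
  function whose derivative is nonpositive by the Lipschitz bound on the gradient.\<close>

lemma lipschitz_gradient_upper_bound:
  fixes f :: "'a::euclidean_space \<Rightarrow> real"
  assumes f: "lipschitz_differentiable Lf f"
  shows "f z \<le> f y + (z - y) \<bullet> gradient f y + Lf / 2 * (norm (z - y))\<^sup>2"
proof -
  define d where "d = z - y"
  define h where
    "h t = f (y + t *\<^sub>R d) - t * (d \<bullet> gradient f y) - Lf / 2 * t\<^sup>2 * (norm d)\<^sup>2" for t
  have "h 1 \<le> h 0"
  proof (rule DERIV_nonpos_imp_nonincreasing[where f = h])
    fix t :: real assume t: "0 \<le> t" "t \<le> 1"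
    let ?D = "d \<bullet> (gradient f (y + t *\<^sub>R d) - gradient f y) - Lf * t * (norm d)\<^sup>2"
    have "(f has_derivative (\<lambda>h. h \<bullet> gradient f (y + t *\<^sub>R d))) (at (y + t *\<^sub>R d))"
      using gderiv_gradient f unfolding lipschitz_differentiable_def gderiv_def by blast
    moreover have "((\<lambda>t::real. y + t *\<^sub>R d) has_derivative (\<lambda>t. t *\<^sub>R d)) (at t)"
      by (auto intro!: derivative_eq_intros)
    ultimately have "((\<lambda>t. f (y + t *\<^sub>R d)) has_derivative
        (\<lambda>s. (s *\<^sub>R d) \<bullet> gradient f (y + t *\<^sub>R d))) (at t)"
      by (rule has_derivative_compose[rotated])
    then have "((\<lambda>t. f (y + t *\<^sub>R d)) has_real_derivative
        (d \<bullet> gradient f (y + t *\<^sub>R d))) (at t)"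
      by (simp add: has_field_derivative_def mult_commute_abs)
    then have "(h has_real_derivative ?D) (at t)"
      unfolding h_def by (auto intro!: derivative_eq_intros simp: inner_diff_right)
    moreover have "?D \<le> 0"
    proof -
      have "norm (gradient f (y + t *\<^sub>R d) - gradient f y) \<le> Lf * (t * norm d)"
        using f t lipschitz_onD[of Lf UNIV "gradient f" "y + t *\<^sub>R d" y]
        by (simp add: lipschitz_differentiable_def dist_norm)
      then have "norm d * norm (gradient f (y + t *\<^sub>R d) - gradient f y)
          \<le> norm d * (Lf * (t * norm d))"
        by (intro mult_left_mono) auto
      then show ?thesis
        using norm_cauchy_schwarz[of d "gradient f (y + t *\<^sub>R d) - gradient f y"]
        by (simp add: power2_eq_square algebra_simps)
    qed
    ultimately show "\<exists>D. (h has_real_derivative D) (at t) \<and> D \<le> 0" by blast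
  qed simp
  then show ?thesis by (simp add: h_def d_def)
qed

text \<open>Strong convexity of the model enters twice: at \<open>y\<close>, where it bounds \<open>f\<close> through the
  common gradient, and at the minimizer \<open>z\<close>, where it gives quadratic growth. This is why
  half of the Lipschitz constant suffices as a bound for \<open>M\<close>.\<close>

lemma model_minimization_step_decrease:
  fixes f q \<phi> :: "'a::euclidean_space \<Rightarrow> real"
  assumes f: "lipschitz_differentiable Lf f"
    and diff: "\<And>u. q differentiable (at u)"
    and sc: "strongly_convex M q" and M: "Lf / 2 \<le> M"
    and grad: "gradient q y = gradient f y"
    and \<phi>: "convex_on UNIV \<phi>"
    and min: "\<And>u. q z + \<phi> z \<le> q u + \<phi> u"
  shows "f z + \<phi> z \<le> f y + \<phi> y"
proof -
  note gq = gderiv_gradient[OF diff]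
  let ?n = "(norm (z - y))\<^sup>2"
  have "f z \<le> f y + (z - y) \<bullet> gradient q y + Lf / 2 * ?n"
    using lipschitz_gradient_upper_bound[OF f, of z y] by (simp add: grad)
  moreover have "q y + (z - y) \<bullet> gradient q y + M / 2 * ?n \<le> q z"
    by (rule strongly_convex_lower_bound[OF gq sc])
  moreover have "q z + (y - z) \<bullet> gradient q z + M / 2 * ?n \<le> q y"
    using strongly_convex_lower_bound[OF gq sc, of z y] by (simp add: norm_minus_commute)
  moreover have "\<phi> z - \<phi> y \<le> (y - z) \<bullet> gradient q z"
    by (rule composite_minimizer_variational_inequality[OF gq \<phi> min])
  moreover have "Lf / 2 * ?n \<le> M * ?n"
    using M by (intro mult_right_mono) auto
  ultimately show ?thesis by argo
qed

section \<open>Weights and the weighted absolute value\<close>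

text \<open>For \<open>0 < p < 1\<close> the map \<open>u \<mapsto> u powr p\<close> lies below its tangents; as the slope at
  \<open>b\<close> is the weight, the reweighted penalty majorizes the original one up to a constant.\<close>

lemma powr_le_tangent:
  fixes a b p :: real
  assumes "0 < p" "p < 1" "0 < a" "0 < b"
  shows "a powr p \<le> b powr p + p * b powr (p - 1) * (a - b)"
proof -
  have "a powr p * b powr (1 - p) \<le> p * a + (1 - p) * b"
    using assms by (intro Youngs_inequality_0) auto
  then have "a powr p * b powr (1 - p) * b powr (p - 1) \<le> (p * a + (1 - p) * b) * b powr (p - 1)"
    by (rule mult_right_mono) simp
  moreover have "a powr p * b powr (1 - p) * b powr (p - 1) = a powr p"
    using assms by (simp add: mult.assoc flip: powr_add)
  moreover have "b * b powr (p - 1) = b powr p"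
    using assms by (simp add: powr_mult_base)
  then have "(p * a + (1 - p) * b) * b powr (p - 1)
      = b powr p + p * b powr (p - 1) * a - p * b powr p"
      "p * b powr (p - 1) * b = p * b powr p"
    by (simp_all add: algebra_simps)
  ultimately show ?thesis
    unfolding right_diff_distrib by linarith
qed

lemma weight_pos: "0 < p \<Longrightarrow> 0 < e \<Longrightarrow> 0 < weight p s e"
  by (simp add: weight_def add_nonneg_pos)

text \<open>The weight is strictly decreasing in \<open>\<bar>s\<bar> + e\<close>; the threshold on the right-hand side is
  the point where it takes the value \<open>c\<close>.\<close>

lemma weight_threshold:
  fixes p c e s :: real
  assumes p: "0 < p" "p < 1" and c: "0 < c" and e: "0 < e"
  defines "T \<equiv> (c / p) powr (1 / (p - 1))"
  shows "weight p s e > c \<longleftrightarrow> \<bar>s\<bar> + e < T"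
    and "weight p s e = c \<longleftrightarrow> \<bar>s\<bar> + e = T"
proof -
  define u where "u = \<bar>s\<bar> + e"
  have u: "0 < u" using e by (simp add: u_def add_nonneg_pos)
  have T: "0 < T" "T powr (p - 1) = c / p"
    using p c by (auto simp: T_def powr_powr)
  have w: "weight p s e = p * u powr (p - 1)" by (simp add: weight_def u_def)
  have c': "c = p * T powr (p - 1)" using p T by simp
  have "u < T \<Longrightarrow> T powr (p - 1) < u powr (p - 1)" "T < u \<Longrightarrow> u powr (p - 1) < T powr (p - 1)"
    using powr_less_mono2_neg[of "p - 1"] p u T(1) by auto
  then show "weight p s e > c \<longleftrightarrow> \<bar>s\<bar> + e < T" "weight p s e = c \<longleftrightarrow> \<bar>s\<bar> + e = T"
    unfolding w u_def[symmetric] using p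
    by (subst c', cases u T rule: linorder_cases; simp; fail)+
qed

lemma convex_on_weighted_abs_sum:
  fixes w :: "'n::finite \<Rightarrow> real"
  assumes "0 \<le> c" "\<And>i. 0 \<le> w i"
  shows "convex_on UNIV (\<lambda>z::real^'n. c * (\<Sum>i\<in>UNIV. w i * \<bar>z $ i\<bar>))"
proof (rule convex_on_cmul[OF assms(1)], rule convex_onI)
  fix t :: real and y z :: "real^'n"
  assume t: "0 < t" "t < 1"
  have "w i * \<bar>((1 - t) *\<^sub>R y + t *\<^sub>R z) $ i\<bar>
      \<le> (1 - t) * (w i * \<bar>y $ i\<bar>) + t * (w i * \<bar>z $ i\<bar>)" for i
  proof -
    have "\<bar>((1 - t) *\<^sub>R y + t *\<^sub>R z) $ i\<bar> \<le> (1 - t) * \<bar>y $ i\<bar> + t * \<bar>z $ i\<bar>"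
      using t abs_triangle_ineq[of "(1 - t) * y $ i" "t * z $ i"] by (simp add: abs_mult)
    from mult_left_mono[OF this assms(2)[of i]] show ?thesis by (simp add: algebra_simps)
  qed
  then show "(\<Sum>i\<in>UNIV. w i * \<bar>((1 - t) *\<^sub>R y + t *\<^sub>R z) $ i\<bar>)
      \<le> (1 - t) * (\<Sum>i\<in>UNIV. w i * \<bar>y $ i\<bar>) + t * (\<Sum>i\<in>UNIV. w i * \<bar>z $ i\<bar>)"
    by (simp add: sum_distrib_left sum_mono flip: sum.distrib)
qed simp

text \<open>Comparing the minimizer with the point obtained by erasing its \<open>i\<close>-th coordinate shows
  that a nonzero coordinate would need \<open>c * w i \<le> \<bar>g $ i\<bar>\<close>.\<close>

lemma weighted_l1_minimizer_component_zero:
  fixes q :: "real^'n \<Rightarrow> real"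
  assumes q: "GDERIV q z :> g"
    and c: "0 \<le> c" and w: "\<And>i. 0 \<le> w i"
    and min: "\<And>u. q z + c * (\<Sum>i\<in>UNIV. w i * \<bar>z $ i\<bar>) \<le> q u + c * (\<Sum>i\<in>UNIV. w i * \<bar>u $ i\<bar>)"
    and less: "\<bar>g $ i\<bar> < c * w i"
  shows "z $ i = 0"
proof (rule ccontr)
  assume nz: "z $ i \<noteq> 0"
  define y where "y = z - axis i (z $ i)"
  have y: "y $ j = (if j = i then 0 else z $ j)" for j
    by (simp add: y_def axis_def)
  have "c * (\<Sum>j\<in>UNIV. w j * \<bar>z $ j\<bar>) - c * (\<Sum>j\<in>UNIV. w j * \<bar>y $ j\<bar>) \<le> (y - z) \<bullet> g"
    by (rule composite_minimizer_variational_inequality[OF q convex_on_weighted_abs_sum[OF c w] min])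
  moreover have "(\<Sum>j\<in>UNIV. w j * \<bar>z $ j\<bar>) - (\<Sum>j\<in>UNIV. w j * \<bar>y $ j\<bar>)
      = (\<Sum>j\<in>UNIV. if j = i then w i * \<bar>z $ i\<bar> else 0)"
    unfolding sum_subtractf[symmetric] by (intro sum.cong) (auto simp: y)
  moreover have "(y - z) \<bullet> g = - (z $ i * g $ i)"
    by (simp add: y_def inner_axis')
  ultimately have "c * (w i * \<bar>z $ i\<bar>) \<le> - (z $ i * g $ i)"
    by (simp flip: right_diff_distrib)
  also have "\<dots> \<le> \<bar>g $ i\<bar> * \<bar>z $ i\<bar>"
    by (metis abs_ge_minus_self abs_mult mult.commute)
  also have "\<dots> < c * w i * \<bar>z $ i\<bar>"
    using less nz by (intro mult_strict_right_mono) auto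
  finally show False by simp
qed

section \<open>Descent and boundedness of the iterates\<close>

lemma irl1_sequenceD:
  assumes "irl1_sequence p lam \<mu> Q x \<epsilon>"
  shows "0 < \<epsilon> k $ i"
    and "\<epsilon> (Suc k) $ i \<le> \<mu> * \<epsilon> k $ i"
    and "Q k differentiable (at u)"
    and "Q k (x (Suc k)) + lam * (\<Sum>i\<in>UNIV. weight p (x k $ i) (\<epsilon> k $ i) * \<bar>x (Suc k) $ i\<bar>)
      \<le> Q k u + lam * (\<Sum>i\<in>UNIV. weight p (x k $ i) (\<epsilon> k $ i) * \<bar>u $ i\<bar>)"
  using assms
  by (cases k; auto simp: irl1_sequence_def continuously_differentiable_def is_arg_min_linorder)+

lemma irl1_perturbation_antimono:
  assumes "irl1_sequence p lam \<mu> Q x \<epsilon>" "\<mu> < 1"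
  shows "\<epsilon> (Suc k) $ i < \<epsilon> k $ i"
proof -
  have "\<mu> * \<epsilon> k $ i < 1 * \<epsilon> k $ i"
    using assms(2) irl1_sequenceD(1)[OF assms(1)] by (rule mult_strict_right_mono)
  with irl1_sequenceD(2)[OF assms(1), of k i] show ?thesis by simp
qed

lemma irl1_perturbation_tendsto_0:
  assumes run: "irl1_sequence p lam \<mu> Q x \<epsilon>" and mu: "0 < \<mu>" "\<mu> < 1"
  shows "(\<lambda>k. \<epsilon> k $ i) \<longlonglongrightarrow> 0"
proof (rule tendsto_sandwich)
  have "\<epsilon> k $ i \<le> \<mu> ^ k * \<epsilon> 0 $ i" for k
  proof (induction k)
    case (Suc k)
    have "\<epsilon> (Suc k) $ i \<le> \<mu> * \<epsilon> k $ i" by (rule irl1_sequenceD(2)[OF run])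
    also have "\<dots> \<le> \<mu> * (\<mu> ^ k * \<epsilon> 0 $ i)" using Suc mu by (intro mult_left_mono) auto
    finally show ?case by simp
  qed simp
  then show "\<forall>\<^sub>F k in sequentially. \<epsilon> k $ i \<le> \<mu> ^ k * \<epsilon> 0 $ i" by simp
  show "\<forall>\<^sub>F k in sequentially. 0 \<le> \<epsilon> k $ i"
    using irl1_sequenceD(1)[OF run] by (simp add: less_imp_le)
  have "(\<lambda>k. \<mu> ^ k * \<epsilon> 0 $ i) \<longlonglongrightarrow> 0 * \<epsilon> 0 $ i"
    using mu by (intro tendsto_intros LIMSEQ_realpow_zero) auto
  then show "(\<lambda>k. \<mu> ^ k * \<epsilon> 0 $ i) \<longlonglongrightarrow> 0" by simp
qed simp

lemma irl1_component_zero: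
  fixes x :: "nat \<Rightarrow> real^'n"
  assumes run: "irl1_sequence p lam \<mu> Q x \<epsilon>" and "0 < p" "0 < lam"
    and "\<bar>gradient (Q k) (x (Suc k)) $ i\<bar> < lam * weight p (x k $ i) (\<epsilon> k $ i)"
  shows "x (Suc k) $ i = 0"
proof (rule weighted_l1_minimizer_component_zero)
  show "GDERIV (Q k) (x (Suc k)) :> gradient (Q k) (x (Suc k))"
    by (rule gderiv_gradient[OF irl1_sequenceD(3)[OF run]])
qed (use assms irl1_sequenceD(1,4)[OF run] weight_pos in \<open>auto intro: less_imp_le\<close>)

text \<open>Shrinking the perturbation only lowers the penalty, so it suffices to compare both
  iterates under \<open>\<epsilon> k\<close>; there the tangent bound reduces the claim to the decrease of
  \<open>f\<close> plus the weighted \<open>\<ell>\<^sub>1\<close> term in one model step.\<close>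

lemma irl1_perturbed_objective_decrease:
  fixes f :: "real^'n \<Rightarrow> real"
  assumes run: "irl1_sequence p lam \<mu> Q x \<epsilon>" and p: "0 < p" "p < 1" and lam: "0 < lam"
    and mu: "\<mu> < 1"
    and f: "lipschitz_differentiable Lf f"
    and sc: "strongly_convex M (Q k)" and M: "Lf / 2 \<le> M"
    and grad: "gradient (Q k) (x k) = gradient f (x k)"
  shows "perturbed_objective p lam f (x (Suc k)) (\<epsilon> (Suc k))
    \<le> perturbed_objective p lam f (x k) (\<epsilon> k)"
proof -
  let ?w = "\<lambda>i. weight p (x k $ i) (\<epsilon> k $ i)"
  note eps = irl1_sequenceD(1)[OF run]
  have w: "0 \<le> ?w i" for i using weight_pos[OF p(1) eps] by (simp add: less_imp_le)
  have summand: "(\<bar>x (Suc k) $ i\<bar> + \<epsilon> (Suc k) $ i) powr p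
      \<le> (\<bar>x k $ i\<bar> + \<epsilon> k $ i) powr p + (?w i * \<bar>x (Suc k) $ i\<bar> - ?w i * \<bar>x k $ i\<bar>)" for i
  proof -
    have "(\<bar>x (Suc k) $ i\<bar> + \<epsilon> (Suc k) $ i) powr p \<le> (\<bar>x (Suc k) $ i\<bar> + \<epsilon> k $ i) powr p"
      using irl1_perturbation_antimono[OF run mu, of k i] eps[of "Suc k" i] p
      by (intro powr_mono2) auto
    also have "\<dots> \<le> (\<bar>x k $ i\<bar> + \<epsilon> k $ i) powr p
        + p * (\<bar>x k $ i\<bar> + \<epsilon> k $ i) powr (p - 1)
          * ((\<bar>x (Suc k) $ i\<bar> + \<epsilon> k $ i) - (\<bar>x k $ i\<bar> + \<epsilon> k $ i))"
      using p eps by (intro powr_le_tangent) (auto intro: add_nonneg_pos)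
    finally show ?thesis by (simp add: weight_def algebra_simps)
  qed
  have "(\<Sum>i\<in>UNIV. (\<bar>x (Suc k) $ i\<bar> + \<epsilon> (Suc k) $ i) powr p)
      \<le> (\<Sum>i\<in>UNIV. (\<bar>x k $ i\<bar> + \<epsilon> k $ i) powr p)
        + ((\<Sum>i\<in>UNIV. ?w i * \<bar>x (Suc k) $ i\<bar>) - (\<Sum>i\<in>UNIV. ?w i * \<bar>x k $ i\<bar>))"
    using sum_mono[of UNIV, OF summand] by (simp add: sum.distrib sum_subtractf)
  from mult_left_mono[OF this less_imp_le[OF lam]]
  have pen: "lam * (\<Sum>i\<in>UNIV. (\<bar>x (Suc k) $ i\<bar> + \<epsilon> (Suc k) $ i) powr p)
      \<le> lam * (\<Sum>i\<in>UNIV. (\<bar>x k $ i\<bar> + \<epsilon> k $ i) powr p)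
        + (lam * (\<Sum>i\<in>UNIV. ?w i * \<bar>x (Suc k) $ i\<bar>) - lam * (\<Sum>i\<in>UNIV. ?w i * \<bar>x k $ i\<bar>))"
    by (simp add: algebra_simps)
  have "f (x (Suc k)) + lam * (\<Sum>i\<in>UNIV. ?w i * \<bar>x (Suc k) $ i\<bar>)
      \<le> f (x k) + lam * (\<Sum>i\<in>UNIV. ?w i * \<bar>x k $ i\<bar>)"
    by (rule model_minimization_step_decrease[OF f irl1_sequenceD(3)[OF run] sc M grad
          convex_on_weighted_abs_sum[OF less_imp_le[OF lam] w] irl1_sequenceD(4)[OF run]])
  with pen show ?thesis unfolding perturbed_objective_def by linarith
qed

lemma objective_le_perturbed_objective:
  assumes "0 < p" "0 < lam" "\<And>i. 0 < \<epsilon> $ i"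
  shows "objective p lam f x \<le> perturbed_objective p lam f x \<epsilon>"
  unfolding objective_def perturbed_objective_def using assms
  by (intro add_left_mono mult_left_mono sum_mono powr_mono2) (auto simp: less_imp_le)

text \<open>The unperturbed objective is at most the perturbed one, which never exceeds its initial value;
  hence all iterates lie in the bounded level set. The model gradient at \<open>x (Suc k)\<close> is then
  compared with \<open>gradient f (x 0)\<close> by way of the common gradient at \<open>x k\<close>.\<close>

lemma irl1_model_gradient_bounded:
  fixes f :: "real^'n \<Rightarrow> real"
  assumes run: "irl1_sequence p lam \<mu> Q x \<epsilon>" and p: "0 < p" "p < 1" and lam: "0 < lam"
    and mu: "\<mu> < 1"
    and f: "lipschitz_differentiable Lf f"
    and level: "bounded {z. objective p lam f z \<le> perturbed_objective p lam f (x 0) (\<epsilon> 0)}"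
    and sc: "\<And>k. strongly_convex M (Q k)" and M: "Lf / 2 \<le> M"
    and grad: "\<And>k. gradient (Q k) (x k) = gradient f (x k)"
    and lip: "\<And>k. lipschitz_differentiable L (Q k)"
  shows "\<exists>C>0. \<forall>k. infnorm (gradient (Q k) (x (Suc k))) \<le> C"
proof -
  have "perturbed_objective p lam f (x k) (\<epsilon> k) \<le> perturbed_objective p lam f (x 0) (\<epsilon> 0)" for k
    by (induction k)
      (auto intro: order_trans[OF irl1_perturbed_objective_decrease[OF run p lam mu f sc M grad]])
  then have "objective p lam f (x k) \<le> perturbed_objective p lam f (x 0) (\<epsilon> 0)" for k
    using objective_le_perturbed_objective[OF p(1) lam irl1_sequenceD(1)[OF run]]
    by (blast intro: order_trans)
  with level obtain B where B: "\<And>k. norm (x k) \<le> B"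
    unfolding bounded_iff by blast
  have dist: "norm (x j - x k) \<le> 2 * B" for j k
    using norm_triangle_ineq4[of "x j" "x k"] B[of j] B[of k] by linarith
  have nn: "0 \<le> Lf" "0 \<le> L"
    using f lip lipschitz_on_nonneg unfolding lipschitz_differentiable_def by blast+
  define C where "C = L * (2 * B) + Lf * (2 * B) + norm (gradient f (x 0)) + 1"
  have bound: "infnorm (gradient (Q k) (x (Suc k))) \<le> C" for k
  proof -
    have "norm (gradient (Q k) (x (Suc k)) - gradient (Q k) (x k)) \<le> L * norm (x (Suc k) - x k)"
      using lip[of k] lipschitz_onD[of L UNIV "gradient (Q k)"]
      by (simp add: lipschitz_differentiable_def dist_norm)
    also have "\<dots> \<le> L * (2 * B)" using dist nn by (intro mult_left_mono) auto
    finally have 1: "norm (gradient (Q k) (x (Suc k)) - gradient f (x k)) \<le> L * (2 * B)"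
      by (simp add: grad)
    have "norm (gradient f (x k) - gradient f (x 0)) \<le> Lf * norm (x k - x 0)"
      using f lipschitz_onD[of Lf UNIV "gradient f"]
      by (simp add: lipschitz_differentiable_def dist_norm)
    also have "\<dots> \<le> Lf * (2 * B)" using dist nn by (intro mult_left_mono) auto
    finally have "norm (gradient f (x k) - gradient f (x 0)) \<le> Lf * (2 * B)" .
    then have "norm (gradient (Q k) (x (Suc k))) \<le> C"
      using 1 norm_triangle_ineq2[of "gradient (Q k) (x (Suc k))" "gradient f (x k)"]
        norm_triangle_ineq2[of "gradient f (x k)" "gradient f (x 0)"]
      by (simp add: C_def)
    then show ?thesis using infnorm_le_norm order_trans by blast
  qed
  have "0 \<le> B" using B[of 0] norm_ge_zero order_trans by blast
  then have "0 < C" using nn by (simp add: C_def add_nonneg_pos)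
  with bound show ?thesis by blast
qed

section \<open>Stabilization of the support\<close>

text \<open>Once \<open>\<bar>a k\<bar> + e k\<close> drops below the threshold, \<open>a\<close> vanishes at the next index, and
  the sum becomes the even smaller number \<open>e (Suc k)\<close>; the condition reproduces itself.\<close>

lemma zero_after_threshold:
  fixes a e :: "nat \<Rightarrow> real"
  assumes dec: "\<And>k. e (Suc k) \<le> e k"
    and step: "\<And>k. \<bar>a k\<bar> + e k < T \<Longrightarrow> a (Suc k) = 0"
    and start: "\<bar>a m\<bar> + e m < T" and "m < k"
  shows "a k = 0"
proof -
  have "a (Suc (m + j)) = 0 \<and> \<bar>a (m + j)\<bar> + e (m + j) < T" for j
  proof (induction j)
    case 0
    show ?case using start step by simp
  next
    case (Suc j)
    then have "\<bar>a (m + Suc j)\<bar> + e (m + Suc j) < T"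
      using dec[of "m + j"] by (simp add: abs_if split: if_splits)
    then show ?case using step by simp
  qed
  with less_imp_Suc_add[OF \<open>m < k\<close>] show ?thesis by blast
qed

theorem theorem2p4:
  fixes f :: "real^'n \<Rightarrow> real" and Q :: "nat \<Rightarrow> real^'n \<Rightarrow> real"
    and x \<epsilon> :: "nat \<Rightarrow> real^'n" and p lam \<mu> Lf M L :: real
  assumes p: "0 < p" "p < 1"
    and lam: "0 < lam"
    and mu: "0 < \<mu>" "\<mu> < 1"
    and f_C1: "continuously_differentiable f"
    and f_lip: "lipschitz_differentiable Lf f"
    and level: "bounded {z. objective p lam f z \<le> perturbed_objective p lam f (x 0) (\<epsilon> 0)}"
    and grad_Q: "\<And>k. gradient (Q k) (x k) = gradient f (x k)"
    and M: "M > Lf / 2" "M > 0"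
    and Q_sc: "\<And>k. strongly_convex M (Q k)"
    and L: "L > 0"
    and Q_lip: "\<And>k. lipschitz_differentiable L (Q k)"
    and run: "irl1_sequence p lam \<mu> Q x \<epsilon>"
  shows
    "(\<exists>C>0. \<forall>k. infnorm (gradient (Q k) (x (Suc k))) \<le> C) \<and>
     (\<forall>C>0. (\<forall>k. infnorm (gradient (Q k) (x (Suc k))) \<le> C) \<longrightarrow>
       (\<forall>i. (\<forall>k0. weight p (x k0 $ i) (\<epsilon> k0 $ i) > C / lam \<longrightarrow> (\<forall>k>k0. x k $ i = 0)) \<and>
            ((\<forall>k0. \<exists>k1>k0. x k1 $ i \<noteq> 0) \<longrightarrow>
              (\<forall>k. weight p (x k $ i) (\<epsilon> k $ i) \<le> C / lam))) \<and>
       (\<exists>I\<^sub>s A\<^sub>s.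
         I\<^sub>s \<union> A\<^sub>s = UNIV \<and>
         (\<exists>kbar>0. \<forall>k>kbar. nonzero_indices (x k) = I\<^sub>s \<and> zero_indices (x k) = A\<^sub>s) \<and>
         (\<forall>i\<in>I\<^sub>s.
           (\<forall>k. \<bar>x k $ i\<bar> \<ge> (C / (p * lam)) powr (1 / (p - 1)) - \<epsilon> k $ i) \<and>
           (\<forall>k. infnorm (gradient (Q k) (x (Suc k))) < C \<longrightarrow>
              \<bar>x k $ i\<bar> > (C / (p * lam)) powr (1 / (p - 1)) - \<epsilon> k $ i) \<and>
           (\<exists>k1. \<forall>k>k1. (C / (p * lam)) powr (1 / (p - 1)) - \<epsilon> k $ i > 0)) \<and>
         (\<exists>k1. \<exists>\<delta>>0. \<forall>k>k1. \<forall>i\<in>I\<^sub>s. \<bar>x k $ i\<bar> \<ge> \<delta>) \<and>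
         (\<forall>xstar r. strict_mono r \<and> (\<lambda>j. x (r j)) \<longlonglongrightarrow> xstar \<longrightarrow>
           nonzero_indices xstar = I\<^sub>s \<and> zero_indices xstar = A\<^sub>s \<and>
           (\<forall>i\<in>I\<^sub>s. \<bar>xstar $ i\<bar> \<ge> (C / (p * lam)) powr (1 / (p - 1))))))"
proof (intro conjI allI impI)
  show "\<exists>C>0. \<forall>k. infnorm (gradient (Q k) (x (Suc k))) \<le> C"
    using M by (intro irl1_model_gradient_bounded[OF run p lam mu(2) f_lip level Q_sc _ grad_Q Q_lip]) simp
next
  fix C :: real
  assume C: "0 < C" and bound: "\<forall>k. infnorm (gradient (Q k) (x (Suc k))) \<le> C"
  define T where "T = (C / (p * lam)) powr (1 / (p - 1))"
  note eps = irl1_sequenceD(1)[OF run]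
  note dec = irl1_perturbation_antimono[OF run mu(2)]
  have T0: "0 < T" using C p lam by (simp add: T_def)
  have "C / lam / p = C / (p * lam)" by simp
  then have thr: "weight p (x k $ i) (\<epsilon> k $ i) > C / lam \<longleftrightarrow> \<bar>x k $ i\<bar> + \<epsilon> k $ i < T"
      "weight p (x k $ i) (\<epsilon> k $ i) = C / lam \<longleftrightarrow> \<bar>x k $ i\<bar> + \<epsilon> k $ i = T" for k i
    using weight_threshold[OF p divide_pos_pos[OF C lam] eps] by (simp_all only: T_def)
  have step: "x (Suc k) $ i = 0" if "\<bar>x k $ i\<bar> + \<epsilon> k $ i < T" for k i
  proof (rule irl1_component_zero[OF run p(1) lam])
    have "\<bar>gradient (Q k) (x (Suc k)) $ i\<bar> \<le> C"
      using component_le_infnorm_cart bound order_trans by blast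
    also have "C < lam * weight p (x k $ i) (\<epsilon> k $ i)"
      using that lam by (simp add: pos_divide_less_eq mult.commute flip: thr(1))
    finally show "\<bar>gradient (Q k) (x (Suc k)) $ i\<bar> < lam * weight p (x k $ i) (\<epsilon> k $ i)" .
  qed
  have absorb: "x k $ i = 0" if "\<bar>x m $ i\<bar> + \<epsilon> m $ i < T" "m < k" for m k i
    by (rule zero_after_threshold[of "\<lambda>k. \<epsilon> k $ i" "\<lambda>k. x k $ i", OF less_imp_le[OF dec] step that])
  \<comment> \<open>The final support: the coordinates that never get stuck at zero.\<close>
  define I where "I = {i. \<forall>m. \<exists>k>m. x k $ i \<noteq> 0}"
  have I_ge: "T \<le> \<bar>x k $ i\<bar> + \<epsilon> k $ i" if i: "i \<in> I" for k i
  proof (rule ccontr)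
    assume "\<not> ?thesis"
    then have "x m $ i = 0" if "k < m" for m using that by (intro absorb[of k]) auto
    moreover obtain m where "k < m" "x m $ i \<noteq> 0" using i by (auto simp: I_def)
    ultimately show False by blast
  qed
  have small: "\<exists>k1. \<forall>k>k1. \<forall>i. \<epsilon> k $ i < T / 2"
  proof -
    have "\<forall>\<^sub>F k in sequentially. \<epsilon> k $ i < T / 2" for i
      using irl1_perturbation_tendsto_0[OF run mu, of i] T0 by (intro order_tendstoD(2)) auto
    then have "\<forall>\<^sub>F k in sequentially. \<forall>i. \<epsilon> k $ i < T / 2"
      by (rule eventually_all_finite)
    then show ?thesis unfolding eventually_sequentially by (meson less_imp_le)
  qed
  then obtain k1 where k1: "\<And>k i. k1 < k \<Longrightarrow> \<epsilon> k $ i < T / 2" by blast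
  have I_away: "T / 2 \<le> \<bar>x k $ i\<bar>" if "i \<in> I" "k1 < k" for k i
    using I_ge[OF that(1), of k] k1[OF that(2), of i] by (simp add: field_simps)
  obtain kbar where kbar: "0 < kbar" "k1 \<le> kbar" "\<And>k i. kbar < k \<Longrightarrow> i \<notin> I \<Longrightarrow> x k $ i = 0"
  proof -
    have "\<forall>\<^sub>F k in sequentially. i \<notin> I \<longrightarrow> x k $ i = 0" for i
      unfolding I_def eventually_at_top_dense by simp metis
    then have "\<forall>\<^sub>F k in sequentially. \<forall>i. i \<notin> I \<longrightarrow> x k $ i = 0"
      by (rule eventually_all_finite)
    then obtain N where "\<And>k i. N \<le> k \<Longrightarrow> i \<notin> I \<Longrightarrow> x k $ i = 0"
      unfolding eventually_sequentially by blast
    then show ?thesis by (intro that[of "Suc (max N k1)"]) auto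
  qed
  have supp: "x k $ i \<noteq> 0 \<longleftrightarrow> i \<in> I" if "kbar < k" for k i
  proof (cases "i \<in> I")
    case True
    have "k1 < k" using that kbar(2) by simp
    from I_away[OF True this] T0 True show ?thesis by auto
  next
    case False
    with kbar(3)[OF that] show ?thesis by simp
  qed

  show "x k $ i = 0" if "C / lam < weight p (x k0 $ i) (\<epsilon> k0 $ i)" "k0 < k" for i k0 k
    using absorb that by (metis thr(1))
  show "weight p (x k $ i) (\<epsilon> k $ i) \<le> C / lam" if "\<forall>k0. \<exists>k1>k0. x k1 $ i \<noteq> 0" for i k
    using I_ge[of i k] thr(1)[of k i] that by (simp add: I_def not_less)
  show "\<exists>I\<^sub>s A\<^sub>s.
         I\<^sub>s \<union> A\<^sub>s = UNIV \<and>
         (\<exists>kbar>0. \<forall>k>kbar. nonzero_indices (x k) = I\<^sub>s \<and> zero_indices (x k) = A\<^sub>s) \<and>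
         (\<forall>i\<in>I\<^sub>s.
           (\<forall>k. \<bar>x k $ i\<bar> \<ge> (C / (p * lam)) powr (1 / (p - 1)) - \<epsilon> k $ i) \<and>
           (\<forall>k. infnorm (gradient (Q k) (x (Suc k))) < C \<longrightarrow>
              \<bar>x k $ i\<bar> > (C / (p * lam)) powr (1 / (p - 1)) - \<epsilon> k $ i) \<and>
           (\<exists>k1. \<forall>k>k1. (C / (p * lam)) powr (1 / (p - 1)) - \<epsilon> k $ i > 0)) \<and>
         (\<exists>k1. \<exists>\<delta>>0. \<forall>k>k1. \<forall>i\<in>I\<^sub>s. \<bar>x k $ i\<bar> \<ge> \<delta>) \<and>
         (\<forall>xstar r. strict_mono r \<and> (\<lambda>j. x (r j)) \<longlonglongrightarrow> xstar \<longrightarrow>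
           nonzero_indices xstar = I\<^sub>s \<and> zero_indices xstar = A\<^sub>s \<and>
           (\<forall>i\<in>I\<^sub>s. \<bar>xstar $ i\<bar> \<ge> (C / (p * lam)) powr (1 / (p - 1))))"
    unfolding T_def[symmetric]
  proof (rule exI[of _ I], rule exI[of _ "- I"], intro conjI ballI allI impI)
    show "\<exists>kbar>0. \<forall>k>kbar. nonzero_indices (x k) = I \<and> zero_indices (x k) = - I"
      using kbar(1) supp unfolding nonzero_indices_def zero_indices_def
      by (intro exI[of _ kbar]) auto
    show "T - \<epsilon> k $ i \<le> \<bar>x k $ i\<bar>" if "i \<in> I" for i k
      using I_ge[OF that, of k] by simp
    show "T - \<epsilon> k $ i < \<bar>x k $ i\<bar>"
      if i: "i \<in> I" and less: "infnorm (gradient (Q k) (x (Suc k))) < C" for i k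
    \<comment> \<open>Equality in the threshold is excluded because the next iterate would vanish in coordinate
      \<open>i\<close> with a strictly smaller perturbation, which puts it below the threshold.\<close>
    proof (rule ccontr)
      assume "\<not> ?thesis"
      with I_ge[OF i, of k] have eq: "\<bar>x k $ i\<bar> + \<epsilon> k $ i = T" by simp
      then have "lam * weight p (x k $ i) (\<epsilon> k $ i) = C"
        using lam by (simp flip: thr(2))
      with less component_le_infnorm_cart[of "gradient (Q k) (x (Suc k))" i]
      have "x (Suc k) $ i = 0"
        by (intro irl1_component_zero[OF run p(1) lam]) simp
      with I_ge[OF i, of "Suc k"] dec[of k i] eq show False by simp
    qed
    show "\<exists>k1. \<forall>k>k1. 0 < T - \<epsilon> k $ i" for i
    proof (intro exI allI impI)
      fix k assume "k1 < k"
      from k1[OF this, of i] T0 show "0 < T - \<epsilon> k $ i" by simp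
    qed
    show "\<exists>k1. \<exists>\<delta>>0. \<forall>k>k1. \<forall>i\<in>I. \<delta> \<le> \<bar>x k $ i\<bar>"
      using I_away T0 by (intro exI[of _ k1] exI[of _ "T / 2"]) auto
    fix xstar r assume "strict_mono r \<and> (\<lambda>j. x (r j)) \<longlonglongrightarrow> xstar"
    then have r: "strict_mono r" and lim: "(\<lambda>j. x (r j)) \<longlonglongrightarrow> xstar" by auto
    have lim_i: "(\<lambda>j. x (r j) $ i) \<longlonglongrightarrow> xstar $ i" for i
      using lim by (rule tendsto_vec_nth)
    have xI: "T \<le> \<bar>xstar $ i\<bar>" if "i \<in> I" for i
    proof (rule tendsto_lowerbound)
      have "(\<lambda>j. \<bar>x (r j) $ i\<bar> + \<epsilon> (r j) $ i) \<longlonglongrightarrow> \<bar>xstar $ i\<bar> + 0"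
        using LIMSEQ_subseq_LIMSEQ[OF irl1_perturbation_tendsto_0[OF run mu] r]
        by (intro tendsto_intros lim_i) (simp add: o_def)
      then show "(\<lambda>j. \<bar>x (r j) $ i\<bar> + \<epsilon> (r j) $ i) \<longlonglongrightarrow> \<bar>xstar $ i\<bar>" by simp
      show "\<forall>\<^sub>F j in sequentially. T \<le> \<bar>x (r j) $ i\<bar> + \<epsilon> (r j) $ i"
        using I_ge[OF that] by simp
    qed simp
    then show "T \<le> \<bar>xstar $ i\<bar>" if "i \<in> I" for i using that by blast
    have xA: "xstar $ i = 0" if "i \<notin> I" for i
    proof -
      have "\<forall>\<^sub>F j in sequentially. kbar < r j"
        by (rule eventually_compose_filterlim[OF eventually_gt_at_top filterlim_subseq[OF r]])
      then have "\<forall>\<^sub>F j in sequentially. x (r j) $ i = 0"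
        by eventually_elim (use kbar(3) that in blast)
      then have "(\<lambda>j. x (r j) $ i) \<longlonglongrightarrow> 0" by (rule tendsto_eventually)
      with lim_i show ?thesis using LIMSEQ_unique by blast
    qed
    show "nonzero_indices xstar = I" "zero_indices xstar = - I"
      using xI xA T0 unfolding nonzero_indices_def zero_indices_def by force+
  qed simp
qed

end
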